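(* Every locally finite division ring is weakly locally finite.
   Context: A division ring $D$ is centrally finite if it is finite-dimensional as a vector space over its center. A division ring $D$ with center $F$ is locally finite if for every finite subset $S$ of $D$, the division subring $F(S)$ of $D$ generated by $S\cup F$ is a finite-dimensional vector space over $F$. A division ring $D$ is weakly locally finite if for every finite subset $S$ of $D$, the division subring of $D$ generated by $S$ is centrally finite (i.e. finite-dimensional over its own center). *)

theory Defs
  imports "HOL-Algebra.Embedded_Algebras"
begin

text \<open>
  The library's locale \<^locale>\<open>field\<close> (and hence \<^locale>\<open>subfield\<close>) is commutative, so division
  rings and their division subrings are set up here in the same style.
\<close>

locale div_ring = ring +
  assumes one_not_zero [simp]: "\<one> \<noteq> \<zero>"
    and div_ring_Units: "Units R = carrier R - {\<zero>}"

definition div_subring :: "'a set \<Rightarrow> ('a, 'b) ring_scheme \<Rightarrow> bool"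
  where "div_subring K R \<longleftrightarrow> subring K R \<and> div_ring (R\<lparr>carrier := K\<rparr>)"

definition gen_div_subring :: "('a, 'b) ring_scheme \<Rightarrow> 'a set \<Rightarrow> 'a set"
  where "gen_div_subring R S = \<Inter> {K. div_subring K R \<and> S \<subseteq> K}"

definition center :: "('a, 'b) ring_scheme \<Rightarrow> 'a set"
  where "center R = {z \<in> carrier R. \<forall>x \<in> carrier R. z \<otimes>\<^bsub>R\<^esub> x = x \<otimes>\<^bsub>R\<^esub> z}"

text \<open>
  In \<open>ring.finite_dimension R K E\<close> the set \<open>K\<close> is the scalar field and acts by left multiplication
  in \<open>R\<close>; the side is immaterial below, because the scalars are always central in the space \<open>E\<close>.
\<close>

definition centrally_finite :: "('a, 'b) ring_scheme \<Rightarrow> bool"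
  where "centrally_finite R \<longleftrightarrow> ring.finite_dimension R (center R) (carrier R)"

definition locally_finite :: "('a, 'b) ring_scheme \<Rightarrow> bool"
  where "locally_finite R \<longleftrightarrow>
    (\<forall>S. finite S \<and> S \<subseteq> carrier R \<longrightarrow>
      ring.finite_dimension R (center R) (gen_div_subring R (S \<union> center R)))"

definition weakly_locally_finite :: "('a, 'b) ring_scheme \<Rightarrow> bool"
  where "weakly_locally_finite R \<longleftrightarrow>
    (\<forall>S. finite S \<and> S \<subseteq> carrier R \<longrightarrow>
      centrally_finite (R\<lparr>carrier := gen_div_subring R S\<rparr>))"


text \<open>
  The library constrains neither argument of \<open>finite_dimension\<close>; the facts below show that it is
  only applied to a subfield of a ring.
\<close>

lemma (in div_ring) m_inv_closed:
  assumes "x \<in> carrier R" "x \<noteq> \<zero>"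
  shows "inv x \<in> carrier R" "x \<otimes> inv x = \<one>" "inv x \<otimes> x = \<one>"
  using assms div_ring_Units by auto

lemma (in div_ring) div_subring_iff:
  "div_subring K R \<longleftrightarrow> subring K R \<and> (\<forall>x \<in> K - {\<zero>}. inv x \<in> K)"
proof (cases "subring K R")
  case False
  then show ?thesis by (simp add: div_subring_def)
next
  case True
  note K = subringE[OF True]
  interpret K: ring "R\<lparr>carrier := K\<rparr>"
    by (rule subring_is_ring[OF True])
  show ?thesis
  proof
    assume "div_subring K R"
    then interpret KD: div_ring "R\<lparr>carrier := K\<rparr>"
      by (simp add: div_subring_def)
    have "inv x \<in> K" if x: "x \<in> K - {\<zero>}" for x
    proof -
      have "x \<in> Units (R\<lparr>carrier := K\<rparr>)"
        using x KD.div_ring_Units by simp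
      then obtain y where y: "y \<in> K" "y \<otimes> x = \<one>" "x \<otimes> y = \<one>"
        by (auto simp: Units_def)
      moreover have "x \<in> carrier R" "y \<in> carrier R"
        using x y(1) K(1) by auto
      ultimately have "y = inv x"
        by (intro inv_unique') auto
      with y(1) show ?thesis by simp
    qed
    with True show "subring K R \<and> (\<forall>x \<in> K - {\<zero>}. inv x \<in> K)" by blast
  next
    assume inv: "subring K R \<and> (\<forall>x \<in> K - {\<zero>}. inv x \<in> K)"
    have "x \<in> Units (R\<lparr>carrier := K\<rparr>)" if x: "x \<in> K" "x \<noteq> \<zero>" for x
      proof -
      have "x \<in> carrier R" using x K(1) by auto
      note i = m_inv_closed[OF this x(2)]
      have "inv x \<in> K" using x inv by auto
      with x(1) i show ?thesis unfolding Units_def by auto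
    qed
    moreover have "x \<noteq> \<zero>" if "x \<in> Units (R\<lparr>carrier := K\<rparr>)" for x
    proof
      assume "x = \<zero>"
      with that obtain y where "y \<in> K" "y \<otimes> \<zero> = \<one>" by (auto simp: Units_def)
      with K(1) show False by (metis r_null one_not_zero subsetD)
    qed
    moreover have "x \<in> K" if "x \<in> Units (R\<lparr>carrier := K\<rparr>)" for x
      using that by (auto simp: Units_def)
    ultimately have "Units (R\<lparr>carrier := K\<rparr>) = K - {\<zero>}" by blast
    then have "div_ring (R\<lparr>carrier := K\<rparr>)"
      by (intro div_ring.intro div_ring_axioms.intro K.ring_axioms) simp_all
    with True show "div_subring K R" by (simp add: div_subring_def)
  qed
qed

lemma (in div_ring) gen_div_subring_div_subring:
  assumes "S \<subseteq> carrier R"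
  shows "div_subring (gen_div_subring R S) R"
proof -
  let ?C = "{K. div_subring K R \<and> S \<subseteq> K}"
  have "carrier R \<in> ?C"
    using assms carrier_is_subring m_inv_closed by (auto simp: div_subring_iff)
  then have "?C \<noteq> {}" by blast
  then have "subring (\<Inter> ?C) R"
    by (intro subring_Inter) (auto simp: div_subring_def)
  then show ?thesis
    unfolding gen_div_subring_def div_subring_iff by auto
qed

lemma (in div_ring) center_subfield: "subfield (center R) R"
proof (rule subfieldI)
  have inv_comm: "inv z \<otimes> x = x \<otimes> inv z"
    if z: "z \<in> center R" "z \<noteq> \<zero>" and x: "x \<in> carrier R" for z x
  proof -
    have zc: "z \<in> carrier R" and comm: "z \<otimes> x = x \<otimes> z"
      using z x by (auto simp: center_def)
    note i = m_inv_closed[OF zc z(2)]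
    have "inv z \<otimes> x = inv z \<otimes> (x \<otimes> z) \<otimes> inv z"
      using i zc x by (simp add: m_assoc)
    also have "\<dots> = inv z \<otimes> z \<otimes> x \<otimes> inv z"
      using i(1) zc x by (simp add: comm[symmetric] m_assoc)
    finally show ?thesis using i x by simp
  qed
  have sub: "subring (center R) R"
  proof (rule subringI)
    fix h k assume "h \<in> center R" "k \<in> center R"
    then have hk: "h \<in> carrier R" "k \<in> carrier R"
      "\<And>x. x \<in> carrier R \<Longrightarrow> h \<otimes> x = x \<otimes> h" "\<And>x. x \<in> carrier R \<Longrightarrow> k \<otimes> x = x \<otimes> k"
      by (auto simp: center_def)
    have "h \<otimes> k \<otimes> x = x \<otimes> (h \<otimes> k)" if x: "x \<in> carrier R" for x
    proof -
      have "h \<otimes> k \<otimes> x = h \<otimes> (x \<otimes> k)"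
        using hk(1,2) x by (simp add: m_assoc hk(4)[OF x])
      also have "\<dots> = x \<otimes> h \<otimes> k"
        using hk(1,2) x by (simp add: m_assoc[symmetric] hk(3)[OF x])
      finally show ?thesis using hk(1,2) x by (simp add: m_assoc)
    qed
    with hk(1,2) show "h \<otimes> k \<in> center R" by (simp add: center_def)
    have "(h \<oplus> k) \<otimes> x = x \<otimes> (h \<oplus> k)" if x: "x \<in> carrier R" for x
      using hk(1,2) x by (simp add: l_distr r_distr hk(3)[OF x] hk(4)[OF x])
    with hk(1,2) show "h \<oplus> k \<in> center R" by (simp add: center_def)
  qed (auto simp: center_def l_minus r_minus)
  then show "subcring (center R) R"
    by (rule subcringI) (unfold center_def, blast)
  have "inv z \<in> center R" if z: "z \<in> center R - {\<zero>}" for z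
  proof -
    have "inv z \<in> carrier R"
      using z m_inv_closed(1) by (auto simp: center_def)
    moreover have "\<forall>x \<in> carrier R. inv z \<otimes> x = x \<otimes> inv z"
      using z inv_comm by blast
    ultimately show ?thesis unfolding center_def by blast
  qed
  with sub have "div_subring (center R) R"
    by (simp add: div_subring_iff)
  then show "Units (R\<lparr>carrier := center R\<rparr>) = center R - {\<zero>}"
    using div_ring.div_ring_Units[of "R\<lparr>carrier := center R\<rparr>"] by (simp add: div_subring_def)
qed

end

(* Let K be the division subring generated by S, with center Z, and let F be the center of D.
   Elements of K that are linearly independent over Z stay independent over F, because F commutes
   with K. As K lies in a space of finite dimension over F, its dimension over Z is finite too.
   K need not contain F and F need not contain Z, so dimensions cannot simply be compared in a
   tower of fields. *)
theory Submission
  imports Defs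
begin

section \<open>Finite sums, linear combinations and independent lists\<close>

lemma (in ring) finsum_minus:
  assumes "finite A" "f \<in> A \<rightarrow> carrier R" "g \<in> A \<rightarrow> carrier R"
  shows "(\<Oplus>i\<in>A. f i \<ominus> g i) = (\<Oplus>i\<in>A. f i) \<ominus> (\<Oplus>i\<in>A. g i)"
  using assms
proof (induction A rule: finite_induct)
  case empty
  then show ?case by (simp add: a_minus_def)
next
  case (insert a A)
  then have c: "f a \<in> carrier R" "g a \<in> carrier R" "f \<in> A \<rightarrow> carrier R" "g \<in> A \<rightarrow> carrier R"
    by auto
  then have "(\<lambda>i. f i \<ominus> g i) \<in> A \<rightarrow> carrier R"
    by auto
  moreover have "finsum R f A \<in> carrier R" "finsum R g A \<in> carrier R"
    using c by (auto intro: finsum_closed)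
  ultimately show ?case
    using insert c by (simp add: a_minus_def minus_add a_ac)
qed

text \<open>Linear independence is formulated with lists, while the arguments below discard single
  indices and induct on finite index sets. This lemma mediates between the two.\<close>

lemma (in ring) combine_eq_finsum:
  assumes "length Ks = length Us" "set Ks \<subseteq> carrier R" "set Us \<subseteq> carrier R"
  shows "combine Ks Us = (\<Oplus>i\<in>{..<length Us}. Ks ! i \<otimes> Us ! i)"
  using assms
proof (induction Ks Us rule: list_induct2)
  case Nil
  then show ?case by simp
next
  case (Cons k Ks u Us)
  have len: "length Ks = length Us" by fact
  have c: "Ks ! i \<otimes> Us ! i \<in> carrier R" if "i < length Us" for i
    using that len Cons.prems by (auto intro!: m_closed dest: nth_mem)
  have "(\<Oplus>i\<in>{..<length (u # Us)}. (k # Ks) ! i \<otimes> (u # Us) ! i)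
      = (\<Oplus>i\<in>insert 0 (Suc ` {..<length Us}). (k # Ks) ! i \<otimes> (u # Us) ! i)"
    by (simp add: lessThan_Suc_eq_insert_0)
  also have "\<dots> = k \<otimes> u \<oplus> (\<Oplus>i\<in>Suc ` {..<length Us}. (k # Ks) ! i \<otimes> (u # Us) ! i)"
    using Cons.prems c by (subst finsum_insert) auto
  also have "(\<Oplus>i\<in>Suc ` {..<length Us}. (k # Ks) ! i \<otimes> (u # Us) ! i)
      = (\<Oplus>i\<in>{..<length Us}. Ks ! i \<otimes> Us ! i)"
    using c by (subst finsum_reindex) auto
  finally show ?case
    using Cons by simp
qed

text \<open>The recursion for \<open>combine\<close> uses only product, sum and zero, which a
  restriction of the carrier leaves unchanged.\<close>

lemma (in ring) combine_consistent:
  assumes "subring K R"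
  shows "ring.combine (R\<lparr>carrier := K\<rparr>) Ks Us = combine Ks Us"
proof -
  interpret K: ring "R\<lparr>carrier := K\<rparr>"
    by (rule subring_is_ring[OF assms])
  show ?thesis
    by (induction Ks Us rule: combine.induct) simp_all
qed

text \<open>Greedy choice: the span of an independent list has finite dimension, so it is not the
  whole ring, and any element outside it extends the list.\<close>

lemma (in ring) infinite_dimension_imp_independent_list:
  assumes "\<not> finite_dimension K (carrier R)" "subfield K R"
  shows "\<exists>Us. length Us = n \<and> independent K Us"
proof (induction n)
  case 0
  then show ?case by auto
next
  case (Suc n)
  then obtain Us where Us: "length Us = n" "independent K Us" by auto
  have "dimension n K (Span K Us)"
    using dimension_independent[OF Us(2)] Us(1) by simp
  then have "Span K Us \<noteq> carrier R"
    using assms(1) finite_dimensionI[of n K "Span K Us"] by auto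
  moreover have "Span K Us \<subseteq> carrier R"
    using Span_in_carrier[OF subfieldE(3)[OF assms(2)] independent_in_carrier[OF Us(2)]] .
  ultimately obtain u where "u \<in> carrier R" "u \<notin> Span K Us" by blast
  then have "independent K (u # Us)"
    using Us(2) by (intro li_Cons)
  with Us(1) show ?case
    by (intro exI[of _ "u # Us"]) simp
qed

section \<open>Linear relations whose coefficients commute with \<open>K\<close>\<close>

lemma center_of_subset:
  "center (R\<lparr>carrier := K\<rparr>) = {z \<in> K. \<forall>x \<in> K. z \<otimes>\<^bsub>R\<^esub> x = x \<otimes>\<^bsub>R\<^esub> z}"
  by (simp add: center_def)

text \<open>
  The relations \<open>w\<close> form a bimodule over \<open>K\<close>. In one of minimal support, normalized to have an
  entry \<open>\<one>\<close>, every commutator with an element of \<open>K\<close> has smaller support, hence vanishes.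
\<close>

lemma (in div_ring) central_relation:
  assumes K: "div_subring K R" and I: "finite I"
    and c: "\<And>i. i \<in> I \<Longrightarrow> c i \<in> carrier R"
    and comm: "\<And>i x. i \<in> I \<Longrightarrow> x \<in> K \<Longrightarrow> c i \<otimes> x = x \<otimes> c i"
    and w: "\<And>i. i \<in> I \<Longrightarrow> w i \<in> K"
    and rel: "(\<Oplus>i\<in>I. c i \<otimes> w i) = \<zero>"
    and nz: "\<exists>i\<in>I. w i \<noteq> \<zero>"
  shows "\<exists>z j. (\<forall>i\<in>I. z i \<in> center (R\<lparr>carrier := K\<rparr>)) \<and> j \<in> I \<and> z j = \<one>
    \<and> (\<Oplus>i\<in>I. c i \<otimes> z i) = \<zero>"
  using w rel nz
proof (induction "card {i \<in> I. w i \<noteq> \<zero>}" arbitrary: w rule: less_induct)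
  case less
  have sr: "subring K R" and invK: "\<And>x. x \<in> K \<Longrightarrow> x \<noteq> \<zero> \<Longrightarrow> inv x \<in> K"
    using K by (auto simp: div_subring_iff)
  note KE = subringE[OF sr]
  have Kc: "x \<in> K \<Longrightarrow> x \<in> carrier R" for x
    using KE(1) by auto
  obtain j where j: "j \<in> I" "w j \<noteq> \<zero>"
    using less.prems(3) by auto
  define a where "a = inv (w j)"
  have aK: "a \<in> K" and aw: "a \<otimes> w j = \<one>"
    using j less.prems(1) invK m_inv_closed[of "w j"] Kc by (auto simp: a_def)
  define v where "v i = a \<otimes> w i" for i
  have vK: "v i \<in> K" if "i \<in> I" for i
    using that aK less.prems(1) KE(6) by (simp add: v_def)
  have vj: "v j = \<one>" using aw by (simp add: v_def)
  \<comment> \<open>Because \<open>c i\<close> commutes with \<open>K\<close>, a relation may be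
    multiplied by elements of \<open>K\<close> on the left; on the right this is plain
    distributivity.\<close>
  have pull: "c i \<otimes> (x \<otimes> y) = x \<otimes> (c i \<otimes> y)" if "i \<in> I" "x \<in> K" "y \<in> K" for i x y
    using that c[OF that(1)] Kc comm[OF that(1,2)] by (metis m_assoc)
  have relv: "(\<Oplus>i\<in>I. c i \<otimes> v i) = \<zero>"
  proof -
    have "(\<Oplus>i\<in>I. c i \<otimes> v i) = (\<Oplus>i\<in>I. a \<otimes> (c i \<otimes> w i))"
      using pull aK less.prems(1) c Kc by (intro finsum_cong') (auto simp: v_def)
    also have "\<dots> = a \<otimes> (\<Oplus>i\<in>I. c i \<otimes> w i)"
      using I aK less.prems(1) c Kc by (intro finsum_rdistr[symmetric]) auto
    finally show ?thesis
      using less.prems(2) aK Kc by simp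
  qed
  show ?case
  proof (cases "\<forall>i\<in>I. v i \<in> center (R\<lparr>carrier := K\<rparr>)")
    case True
    with vj j relv show ?thesis by blast
  next
    case False
    then obtain i0 x where i0: "i0 \<in> I" and x: "x \<in> K" and ne: "v i0 \<otimes> x \<noteq> x \<otimes> v i0"
      using vK by (auto simp: center_of_subset)
    define u where "u i = x \<otimes> v i \<ominus> v i \<otimes> x" for i
    have uK: "u i \<in> K" if "i \<in> I" for i
      using vK[OF that] x KE(5,6,7) by (simp add: u_def a_minus_def)
    have "(\<Oplus>i\<in>I. c i \<otimes> u i) = (\<Oplus>i\<in>I. x \<otimes> (c i \<otimes> v i) \<ominus> (c i \<otimes> v i) \<otimes> x)"
    proof (intro finsum_cong')
      fix i assume i: "i \<in> I"
      have "c i \<otimes> u i = c i \<otimes> (x \<otimes> v i) \<ominus> c i \<otimes> (v i \<otimes> x)"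
        using c[OF i] Kc[OF x] Kc[OF vK[OF i]] by (simp add: u_def a_minus_def r_distr r_minus)
      then show "c i \<otimes> u i = x \<otimes> (c i \<otimes> v i) \<ominus> (c i \<otimes> v i) \<otimes> x"
        using pull[OF i x vK[OF i]] c[OF i] Kc[OF x] Kc[OF vK[OF i]] by (simp add: m_assoc)
    qed (use c Kc x vK in auto)
    also have "\<dots> = (\<Oplus>i\<in>I. x \<otimes> (c i \<otimes> v i)) \<ominus> (\<Oplus>i\<in>I. (c i \<otimes> v i) \<otimes> x)"
      using I c Kc x vK by (intro finsum_minus) auto
    also have "(\<Oplus>i\<in>I. x \<otimes> (c i \<otimes> v i)) = x \<otimes> (\<Oplus>i\<in>I. c i \<otimes> v i)"
      using I c Kc x vK by (intro finsum_rdistr[symmetric]) auto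
    also have "(\<Oplus>i\<in>I. (c i \<otimes> v i) \<otimes> x) = (\<Oplus>i\<in>I. c i \<otimes> v i) \<otimes> x"
      using I c Kc x vK by (intro finsum_ldistr[symmetric]) auto
    finally have relu: "(\<Oplus>i\<in>I. c i \<otimes> u i) = \<zero>"
      using relv Kc[OF x] by (simp add: a_minus_def)
    \<comment> \<open>Zero entries stay zero, and the entry \<open>\<one>\<close> at
      \<open>j\<close> commutes with \<open>x\<close>, so the support loses at least
      \<open>j\<close>.\<close>
    have "u i = \<zero>" if "i \<in> I" "w i = \<zero>" for i
      using that aK x Kc by (simp add: u_def v_def a_minus_def)
    moreover have "u j = \<zero>"
      using Kc[OF x] by (simp add: u_def vj a_minus_def r_neg)
    ultimately have "{i \<in> I. u i \<noteq> \<zero>} \<subset> {i \<in> I. w i \<noteq> \<zero>}"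
      using j by auto
    then have "card {i \<in> I. u i \<noteq> \<zero>} < card {i \<in> I. w i \<noteq> \<zero>}"
      using I by (intro psubset_card_mono) auto
    \<comment> \<open>This entry keeps the commutator relation nontrivial, as the induction
      hypothesis demands.\<close>
    moreover have "u i0 \<noteq> \<zero>"
      using ne i0 x vK Kc by (metis u_def r_right_minus_eq m_closed)
    ultimately show ?thesis
      using less.hyps[of u] uK relu i0 by blast
  qed
qed

text \<open>Induction on the index set with the \<open>c i\<close> fixed. A central relation among
  the \<open>c i\<close> with an entry \<open>\<one>\<close> at \<open>j\<close> allows
  \<open>c j\<close> to be eliminated, at the price of replacing \<open>k i\<close> by
  \<open>k i - z i k j\<close>. A dependence of these over the center expands to one of the original
  \<open>k i\<close>.\<close>

lemma (in div_ring) dependent_over_center: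
  assumes K: "div_subring K R" and I: "finite I"
    and c: "\<And>i. i \<in> I \<Longrightarrow> c i \<in> carrier R"
    and comm: "\<And>i x. i \<in> I \<Longrightarrow> x \<in> K \<Longrightarrow> c i \<otimes> x = x \<otimes> c i"
    and k: "\<And>i. i \<in> I \<Longrightarrow> k i \<in> K"
    and rel: "(\<Oplus>i\<in>I. c i \<otimes> k i) = \<zero>"
    and nz: "\<exists>i\<in>I. c i \<noteq> \<zero>"
  shows "\<exists>z. (\<forall>i\<in>I. z i \<in> center (R\<lparr>carrier := K\<rparr>)) \<and> (\<exists>i\<in>I. z i \<noteq> \<zero>)
    \<and> (\<Oplus>i\<in>I. z i \<otimes> k i) = \<zero>"
  using I c comm k rel nz
proof (induction I arbitrary: k rule: finite_psubset_induct)
  case (psubset I)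
  let ?Z = "center (R\<lparr>carrier := K\<rparr>)"
  have sr: "subring K R"
    using K by (auto simp: div_subring_iff)
  have "K \<subseteq> carrier R"
    using subringE(1)[OF sr] .
  interpret K: div_ring "R\<lparr>carrier := K\<rparr>"
    using K by (simp add: div_subring_def)
  note ZE = subringE[OF subfieldE(1)[OF K.center_subfield]]
  have ZK: "z \<in> K" if "z \<in> ?Z" for z
    using that by (simp add: center_of_subset)
  have Kc: "x \<in> K \<Longrightarrow> x \<in> carrier R" for x
    using \<open>K \<subseteq> carrier R\<close> by auto
  have Zc: "z \<in> ?Z \<Longrightarrow> z \<in> carrier R" for z
    using ZK Kc by blast
  \<comment> \<open>The negative in \<open>ZE\<close> is that of the restricted ring, whose
    definition refers to its carrier \<open>K\<close>; here the negative of \<open>R\<close> is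
    needed.\<close>
  have negZ: "\<ominus> z \<in> ?Z" if "z \<in> ?Z" for z
  proof -
    have "\<ominus> z \<otimes> x = x \<otimes> \<ominus> z" if "x \<in> K" for x
      using \<open>z \<in> ?Z\<close> Zc[of z] Kc[of x] that by (simp add: center_of_subset l_minus r_minus)
    then show ?thesis
      using subringE(5)[OF sr ZK[OF that]] by (simp add: center_of_subset)
  qed
  have sumZ: "(\<Oplus>i\<in>J. f i) \<in> ?Z" if "finite J" "\<And>i. i \<in> J \<Longrightarrow> f i \<in> ?Z" for J and f :: "'c \<Rightarrow> 'a"
    using that
  proof (induction J rule: finite_induct)
    case empty
    show ?case using ZE(2) by simp
  next
    case (insert x F)
    then show ?case using ZE(7) Zc by (subst finsum_insert) auto
  qed
  note prems = psubset.prems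
  have kc: "k i \<in> carrier R" if "i \<in> I" for i
    using that prems(3) Kc by blast
  show ?case
  proof (cases "\<exists>i\<in>I. k i \<noteq> \<zero>")
    \<comment> \<open>All \<open>k i\<close> vanish, so any coefficients will do;
      \<open>\<one>\<close> is nonzero, and \<open>I\<close> is nonempty by the last
      premise.\<close>
    case False
    then have "(\<Oplus>i\<in>I. \<one> \<otimes> k i) = (\<Oplus>i\<in>I. \<zero>)"
      by (intro finsum_cong') auto
    then have "(\<Oplus>i\<in>I. \<one> \<otimes> k i) = \<zero>" by simp
    then show ?thesis
      using prems(5) ZE(3) by (intro exI[of _ "\<lambda>_. \<one>"]) auto
  next
    case True
    obtain z j where z: "\<And>i. i \<in> I \<Longrightarrow> z i \<in> ?Z" and j: "j \<in> I" "z j = \<one>"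
      and relz: "(\<Oplus>i\<in>I. c i \<otimes> z i) = \<zero>"
      using central_relation[OF K psubset.hyps prems(1-4) True] by blast
    define J where "J = I - {j}"
    have J: "J \<subset> I" "finite J" "I = insert j J" "j \<notin> J"
      using j psubset.hyps by (auto simp: J_def)
    \<comment> \<open>Solving the central relation for \<open>c j\<close> turns \<open>rel\<close> into a relation on \<open>I - {j}\<close> with the
      same coefficients.\<close>
    define k' where "k' i = k i \<ominus> z i \<otimes> k j" for i
    have k'K: "k' i \<in> K" if "i \<in> I" for i
      using that z ZK prems(3) j subringE(5,6,7)[OF sr] by (simp add: k'_def a_minus_def)
    \<comment> \<open>Stated for general \<open>B\<close> and \<open>b\<close> because it serves
      twice: with \<open>c\<close> on \<open>I\<close> to obtain the relation among the
      \<open>k' i\<close>, and with \<open>y\<close> on \<open>J\<close> to return to the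
      \<open>k i\<close>.\<close>
    have combos: "(\<Oplus>i\<in>B. b i \<otimes> k' i) = (\<Oplus>i\<in>B. b i \<otimes> k i) \<ominus> (\<Oplus>i\<in>B. b i \<otimes> z i) \<otimes> k j"
      if "B \<subseteq> I" "\<And>i. i \<in> B \<Longrightarrow> b i \<in> carrier R" for B b
    proof -
      have fB: "finite B" using that psubset.hyps finite_subset by blast
      have "(\<Oplus>i\<in>B. b i \<otimes> k' i) = (\<Oplus>i\<in>B. b i \<otimes> k i \<ominus> b i \<otimes> z i \<otimes> k j)"
      proof (intro finsum_cong')
        fix i assume i: "i \<in> B"
        then have "b i \<in> carrier R" "z i \<in> carrier R" "k i \<in> carrier R" "k j \<in> carrier R"
          using that z Zc kc j by auto
        then show "b i \<otimes> k' i = b i \<otimes> k i \<ominus> b i \<otimes> z i \<otimes> k j"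
          by (simp add: k'_def a_minus_def r_distr r_minus m_assoc)
      qed (use that z Zc kc j in auto)
      also have "\<dots> = (\<Oplus>i\<in>B. b i \<otimes> k i) \<ominus> (\<Oplus>i\<in>B. b i \<otimes> z i \<otimes> k j)"
        using fB that z Zc kc j by (intro finsum_minus) (auto intro!: m_closed)
      also have "(\<Oplus>i\<in>B. b i \<otimes> z i \<otimes> k j) = (\<Oplus>i\<in>B. b i \<otimes> z i) \<otimes> k j"
        using fB that z Zc kc j by (intro finsum_ldistr[symmetric]) (auto intro!: m_closed)
      finally show ?thesis .
    qed
    have split: "(\<Oplus>i\<in>I. f i) = f j \<oplus> (\<Oplus>i\<in>J. f i)" if "\<And>i. i \<in> I \<Longrightarrow> f i \<in> carrier R" for f
      using that J by (simp only: J(3)) (subst finsum_insert, auto)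
    have kj: "k j \<in> carrier R" using kc j by blast
    have "k' j = \<zero>"
      using kj j by (simp add: k'_def a_minus_def r_neg)
    moreover have "(\<Oplus>i\<in>I. c i \<otimes> k' i) = \<zero>"
      using combos[of I c] prems(1,4) relz kj by (simp add: a_minus_def)
    moreover have "(\<Oplus>i\<in>J. c i \<otimes> k' i) \<in> carrier R"
      using J prems(1) k'K Kc by (intro finsum_closed) auto
    ultimately have relJ: "(\<Oplus>i\<in>J. c i \<otimes> k' i) = \<zero>"
      using split[of "\<lambda>i. c i \<otimes> k' i"] prems(1) k'K Kc j by simp
    \<comment> \<open>If every \<open>c i\<close> on \<open>J\<close> were zero, the central
      relation would collapse to \<open>c j = \<zero>\<close>, leaving no nonzero coefficient on
      \<open>I\<close>.\<close>
    have "\<exists>i\<in>J. c i \<noteq> \<zero>"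
    proof (rule ccontr)
      assume *: "\<not> ?thesis"
      then have "(\<Oplus>i\<in>J. c i \<otimes> z i) = (\<Oplus>i\<in>J. \<zero>)"
        using J z Zc by (intro finsum_cong') auto
      then have "c j = \<zero>"
        using split[of "\<lambda>i. c i \<otimes> z i"] relz prems(1) z Zc j by simp
      with * prems(5) J(3) show False by auto
    qed
    then have "\<exists>y. (\<forall>i\<in>J. y i \<in> ?Z) \<and> (\<exists>i\<in>J. y i \<noteq> \<zero>) \<and> (\<Oplus>i\<in>J. y i \<otimes> k' i) = \<zero>"
      using J(3) by (intro psubset.IH[OF J(1)] prems(1,2) k'K relJ) auto
    then obtain y where y: "\<And>i. i \<in> J \<Longrightarrow> y i \<in> ?Z" and ynz: "\<exists>i\<in>J. y i \<noteq> \<zero>"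
      and rely: "(\<Oplus>i\<in>J. y i \<otimes> k' i) = \<zero>"
      by blast
    \<comment> \<open>Expanding \<open>k' i\<close> in the relation for \<open>y\<close> leaves the
      multiple \<open>s\<close> of \<open>k j\<close> to be subtracted, so \<open>- s\<close> is the
      coefficient at \<open>j\<close>.\<close>
    define s where "s = (\<Oplus>i\<in>J. y i \<otimes> z i)"
    have s: "s \<in> ?Z"
      unfolding s_def using J y z ZE(6) by (intro sumZ) auto
    define y' where "y' = y(j := \<ominus> s)"
    have y': "y' i \<in> ?Z" if "i \<in> I" for i
      using that y negZ[OF s] J(3) by (auto simp: y'_def)
    have yk: "(\<Oplus>i\<in>J. y i \<otimes> k i) \<in> carrier R"
      using J y Zc kc by (intro finsum_closed) auto
    have "(\<Oplus>i\<in>J. y i \<otimes> k i) \<ominus> s \<otimes> k j = \<zero>"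
      using combos[of J y] rely J y Zc by (auto simp: s_def)
    then have sk: "(\<Oplus>i\<in>J. y i \<otimes> k i) = s \<otimes> k j"
      using yk Zc[OF s] kj by simp
    have "(\<Oplus>i\<in>I. y' i \<otimes> k i) = y' j \<otimes> k j \<oplus> (\<Oplus>i\<in>J. y' i \<otimes> k i)"
      using y' Zc kc by (intro split) auto
    also have "(\<Oplus>i\<in>J. y' i \<otimes> k i) = (\<Oplus>i\<in>J. y i \<otimes> k i)"
      using J y Zc kc by (intro finsum_cong') (auto simp: y'_def)
    finally have "(\<Oplus>i\<in>I. y' i \<otimes> k i) = \<zero>"
      using sk Zc[OF s] kj by (simp add: y'_def l_minus l_neg)
    moreover have "\<exists>i\<in>I. y' i \<noteq> \<zero>"
      using ynz J by (auto simp: y'_def)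
    ultimately show ?thesis
      using y' by blast
  qed
qed

section \<open>Finite dimension over the center\<close>

text \<open>Were the dimension infinite, \<open>K\<close> would contain more elements independent
  over its center than the dimension of \<open>L\<close> over \<open>F\<close>. They are dependent
  over \<open>F\<close>, and \<open>dependent_over_center\<close> carries the dependence down to the
  center of \<open>K\<close>.\<close>

lemma (in div_ring) finite_dimension_over_center:
  assumes K: "div_subring K R"
    and F: "subfield F R" "\<And>a x. a \<in> F \<Longrightarrow> x \<in> K \<Longrightarrow> a \<otimes> x = x \<otimes> a"
    and L: "finite_dimension F L" "K \<subseteq> L"
  shows "centrally_finite (R\<lparr>carrier := K\<rparr>)"
proof (rule ccontr)
  let ?R' = "R\<lparr>carrier := K\<rparr>"
  let ?Z = "center ?R'"
  have sr: "subring K R"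
    using K by (auto simp: div_subring_iff)
  have Kc: "K \<subseteq> carrier R"
    using subringE(1)[OF sr] .
  interpret K: div_ring ?R'
    using K by (simp add: div_subring_def)
  assume "\<not> centrally_finite ?R'"
  then have inf: "\<not> K.finite_dimension ?Z (carrier ?R')"
    by (simp add: centrally_finite_def)
  obtain n where n: "dimension n F L"
    using L(1) finite_dimension_def by auto
  obtain Us where Us: "length Us = Suc n" "K.independent ?Z Us"
    using K.infinite_dimension_imp_independent_list[OF inf K.center_subfield] by blast
  have UsK: "set Us \<subseteq> K"
    using K.independent_in_carrier[OF Us(2)] by simp
  have "dependent F Us"
    using independent_length_le_dimension[OF F(1) n, of Us] UsK L(2) Us(1) by auto
  then obtain Ks where Ks: "length Ks = length Us" "combine Ks Us = \<zero>" "set Ks \<subseteq> F" "set Ks \<noteq> {\<zero>}"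
    using dependent_imp_non_trivial_combine[OF F(1) order_trans[OF UsK Kc]] by blast
  let ?I = "{..<length Us}"
  have KsF: "Ks ! i \<in> F" if "i \<in> ?I" for i
    using that Ks(1,3) by auto
  have UsiK: "Us ! i \<in> K" if "i \<in> ?I" for i
    using that UsK by auto
  have Fc: "F \<subseteq> carrier R"
    using subfieldE(3)[OF F(1)] .
  have rel: "(\<Oplus>i\<in>?I. Ks ! i \<otimes> Us ! i) = \<zero>"
    using combine_eq_finsum[OF Ks(1)] Ks(2,3) UsK Kc Fc by auto
  have nz: "\<exists>i\<in>?I. Ks ! i \<noteq> \<zero>"
  proof -
    \<comment> \<open>\<open>set Ks \<noteq> {\<zero>}\<close> also holds for the empty list, which
      the length \<open>Suc n\<close> excludes.\<close>
    have "set Ks \<noteq> {}" using Ks(1) Us(1) by auto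
    then obtain a where "a \<in> set Ks" "a \<noteq> \<zero>"
      using Ks(4) by (metis subset_singletonD subsetI singletonI)
    then show ?thesis using Ks(1) by (metis in_set_conv_nth lessThan_iff)
  qed
  obtain z where z: "\<And>i. i \<in> ?I \<Longrightarrow> z i \<in> ?Z" and znz: "\<exists>i\<in>?I. z i \<noteq> \<zero>"
    and relz: "(\<Oplus>i\<in>?I. z i \<otimes> Us ! i) = \<zero>"
    using dependent_over_center[OF K _ _ _ UsiK rel nz] KsF Fc F(2) by blast
  define Zs where "Zs = map z [0..<length Us]"
  have Zs: "length Zs = length Us" "set Zs \<subseteq> ?Z"
    using z by (auto simp: Zs_def)
  have "?Z \<subseteq> carrier R"
    using Kc by (auto simp: center_of_subset)
  then have "combine Zs Us = (\<Oplus>i\<in>?I. Zs ! i \<otimes> Us ! i)"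
    using combine_eq_finsum[OF Zs(1)] Zs(2) UsK Kc by blast
  also have "\<dots> = (\<Oplus>i\<in>?I. z i \<otimes> Us ! i)"
    using z UsiK Kc \<open>?Z \<subseteq> carrier R\<close> by (intro finsum_cong') (auto simp: Zs_def intro!: m_closed)
  finally have "K.combine Zs Us = \<zero>\<^bsub>?R'\<^esub>"
    using relz by (simp add: combine_consistent[OF sr])
  then have "set Zs \<subseteq> {\<zero>}"
    using K.independent_imp_trivial_combine[OF K.center_subfield Us(2) Zs(2)] Zs(1) by simp
  with znz show False by (fastforce simp: Zs_def)
qed

theorem mainTheorem2:
  fixes D :: "('a, 'b) ring_scheme"
  assumes "div_ring D" and "locally_finite D"
  shows "weakly_locally_finite D"
  unfolding weakly_locally_finite_def
proof (intro allI impI)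
  interpret div_ring D by fact
  fix S assume S: "finite S \<and> S \<subseteq> carrier D"
  have K: "div_subring (gen_div_subring D S) D"
    using S by (intro gen_div_subring_div_subring) simp
  then have Kc: "gen_div_subring D S \<subseteq> carrier D"
    using subringE(1) by (auto simp: div_subring_def)
  show "centrally_finite (D\<lparr>carrier := gen_div_subring D S\<rparr>)"
  \<comment> \<open>Here \<open>F\<close> is the center of \<open>D\<close>, and \<open>L\<close> is
    the division subring generated by \<open>S\<close> and \<open>F\<close>, of finite dimension by
    local finiteness.\<close>
  proof (rule finite_dimension_over_center[OF K center_subfield])
    show "finite_dimension (center D) (gen_div_subring D (S \<union> center D))"
      using assms(2) S by (simp add: locally_finite_def)
    show "gen_div_subring D S \<subseteq> gen_div_subring D (S \<union> center D)"
      by (auto simp: gen_div_subring_def)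
  qed (use Kc in \<open>auto simp: center_def\<close>)
qed

end
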